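(* Let $K\ge 2$ and $d_k\ge 2$ ($k=1,\dots,K$) be integers. In the system $\otimes_{k=1}^{K}\mathbb{C}^{d_k}$, the maximal number $T$ such that every set of at most $T$ mutually orthogonal pure states is LOCC$_1$ distinguishable is $T=2$.
   Context: The system $\otimes_{k=1}^K\mathbb{C}^{d_k}$ is shared by parties $A^{(1)},\dots,A^{(K)}$, party $A^{(k)}$ holding $\mathbb{C}^{d_k}$. A POVM is a finite family of positive semidefinite operators summing to the identity. An LOCC$_1$ POVM is one of the form $\{M_{j_1,\dots,j_K}\}$ with $M_{j_1,\dots,j_K}=\otimes_{s=1}^K A^{(s)}_{j_1,\dots,j_{s-1},j_s}$, where for every $s$ and all previous outcomes $j_1,\dots,j_{s-1}$, the family $\{A^{(s)}_{j_1,\dots,j_{s-1},j}\}_{j}$ is a POVM on $\mathbb{C}^{d_s}$ (the parties measure once each, in the order $A^{(1)},\dots,A^{(K)}$, depending on the previously announced outcomes). A set $S$ of states (density operators; a pure state $|\psi\rangle$ is identified with $|\psi\rangle\langle\psi|$) is LOCC$_1$ distinguishable if there is an LOCC$_1$ POVM $\{M_j\}$ such that for every $j$, $\mathrm{Tr}(M_j\rho)\neq 0$ for at most one $\rho\in S$. *)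

theory Defs
  imports "Jordan_Normal_Form.Schur_Decomposition"
begin

definition mat_trace :: "complex mat \<Rightarrow> complex" where
  "mat_trace A = (\<Sum>i<dim_row A. A $$ (i, i))"

(* "0 \<le> z" in the order on complex used here means that z is real and nonnegative. *)
definition psd :: "nat \<Rightarrow> complex mat \<Rightarrow> bool" where
  "psd n A \<longleftrightarrow> A \<in> carrier_mat n n \<and> mat_adjoint A = A \<and>
     (\<forall>v \<in> carrier_vec n. 0 \<le> (A *\<^sub>v v) \<bullet>c v)"

definition povm :: "nat \<Rightarrow> 'i set \<Rightarrow> ('i \<Rightarrow> complex mat) \<Rightarrow> bool" where
  "povm n I E \<longleftrightarrow> finite I \<and> (\<forall>i\<in>I. psd n (E i)) \<and>
     mat n n (\<lambda>p. \<Sum>i\<in>I. E i $$ p) = 1\<^sub>m n"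

(* Kronecker product: the basis vector e_i \<otimes> e_k is identified with the standard basis vector of
   index i * n + k, where n is the dimension of the second factor. *)
definition kron :: "complex mat \<Rightarrow> complex mat \<Rightarrow> complex mat" where
  "kron A B = mat (dim_row A * dim_row B) (dim_col A * dim_col B)
     (\<lambda>(i, j). A $$ (i div dim_row B, j div dim_col B) * B $$ (i mod dim_row B, j mod dim_col B))"

definition tensor :: "complex mat list \<Rightarrow> complex mat" where
  "tensor As = foldr kron As (1\<^sub>m 1)"

(* The parties are numbered 0, ..., K-1; party s holds a space of dimension d s, and the total
   space is identified with the vectors of length sys_dim K d, compatibly with tensor. *)
definition sys_dim :: "nat \<Rightarrow> (nat \<Rightarrow> nat) \<Rightarrow> nat" where
  "sys_dim K d = (\<Prod>k<K. d k)"

(* The possible records of outcomes of the first s measurements, when "out js" is the set of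
   outcomes of the measurement performed after the record js. *)
definition records :: "(nat list \<Rightarrow> nat set) \<Rightarrow> nat \<Rightarrow> nat list set" where
  "records out s = {js. length js = s \<and> (\<forall>t<s. js ! t \<in> out (take t js))}"

(* "A js j" is the operator for outcome j of the measurement made, after the record js, by the
   party of number "length js". *)
definition locc1_povm ::
  "nat \<Rightarrow> (nat \<Rightarrow> nat) \<Rightarrow> nat list set \<Rightarrow> (nat list \<Rightarrow> complex mat) \<Rightarrow> bool" where
  "locc1_povm K d J M \<longleftrightarrow> (\<exists>out A.
     (\<forall>s<K. \<forall>js \<in> records out s. povm (d s) (out js) (A js)) \<and>
     J = records out K \<and>
     (\<forall>js\<in>J. M js = tensor (map (\<lambda>s. A (take s js) (js ! s)) [0..<K])))"

definition locc1_distinguishable :: "nat \<Rightarrow> (nat \<Rightarrow> nat) \<Rightarrow> complex mat set \<Rightarrow> bool" where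
  "locc1_distinguishable K d S \<longleftrightarrow> (\<exists>J M. locc1_povm K d J M \<and>
     (\<forall>js\<in>J. \<forall>\<rho>\<in>S. \<forall>\<sigma>\<in>S. mat_trace (M js * \<rho>) \<noteq> 0 \<longrightarrow> mat_trace (M js * \<sigma>) \<noteq> 0 \<longrightarrow> \<rho> = \<sigma>))"

definition pure_states :: "nat \<Rightarrow> complex vec set" where
  "pure_states n = {\<psi> \<in> carrier_vec n. \<psi> \<bullet>c \<psi> = 1}"

(* The density operator of the pure state \<psi>. *)
definition ket_bra :: "complex vec \<Rightarrow> complex mat" where
  "ket_bra \<psi> = mat (dim_vec \<psi>) (dim_vec \<psi>) (\<lambda>(i, j). \<psi> $ i * cnj (\<psi> $ j))"

definition all_orthogonal_sets_distinguishable :: "nat \<Rightarrow> (nat \<Rightarrow> nat) \<Rightarrow> nat \<Rightarrow> bool" where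
  "all_orthogonal_sets_distinguishable K d T \<longleftrightarrow>
     (\<forall>\<Psi> \<subseteq> pure_states (sys_dim K d).
        finite \<Psi> \<and> card \<Psi> \<le> T \<and> pairwise (\<lambda>\<psi> \<phi>. \<psi> \<bullet>c \<phi> = 0) \<Psi> \<longrightarrow>
        locc1_distinguishable K d (ket_bra ` \<Psi>))"

end

(* Two orthogonal vectors: let the first party measure {|v_j><v_j|}, where the v_j resolve the identity
   and v_j^* Z v_j = 0 for the traceless cross Gram matrix Z of the two vectors. The conditional
   vectors of the remaining parties are then orthogonal again, and induction on the number of parties
   ends with two scalars of product 0. Such v_j are found by rotating pairs of vectors, first
   annihilating the Hermitian and then the anti-Hermitian part of Z.

   Three vectors: three Bell states of the first two parties (the others in |0>) cannot even be
   distinguished by effects of product form, since such an effect overlaps a Bell state in at most half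
   of its trace. *)
theory Submission
  imports Defs
begin

section \<open>Isotropic frames of traceless matrices\<close>

text \<open>Orthogonality of the two whole vectors says only that the conditional inner products
  v_j^* Z v_j sum to 0, since their sum is the trace of Z. The first party therefore has to pick a
  basis in which every one of them vanishes. The obstacle is that Z is not Hermitian: its Hermitian
  and anti-Hermitian parts must vanish on the same basis. The second pass can keep what the first
  achieved because, on two vectors that are already isotropic for the first form, a rotation brings
  in only a cross term, and the relative phase is still free to remove it. In the three-state part,
  the bound by half the trace is where product form matters. The cross terms of E tensor F have the
  same modulus when one index pair is swapped (partial transposition), so they are controlled by the
  two diagonal entries outside the support of the Bell state. The two-qubit subspace has dimension
  4, so at most 4 / 2 = 2 Bell states can be accommodated, and a third gives the
  contradiction.\<close>

definition sform :: "nat \<Rightarrow> (nat \<Rightarrow> nat \<Rightarrow> complex) \<Rightarrow> (nat \<Rightarrow> complex) \<Rightarrow> (nat \<Rightarrow> complex) \<Rightarrow> complex" where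
  "sform n Z v w = (\<Sum>k<n. \<Sum>l<n. cnj (v k) * Z k l * w l)"

text \<open>Imposed at all indices rather than below a dimension, which spares bounds; the arrays it
  is used for are given by formulas valid everywhere.\<close>

definition hermitian_array :: "(nat \<Rightarrow> nat \<Rightarrow> complex) \<Rightarrow> bool" where
  "hermitian_array Z \<longleftrightarrow> (\<forall>k l. Z l k = cnj (Z k l))"

text \<open>Completeness, sum of |v_j><v_j| = 1, stated entrywise. For n vectors in dimension n it
  is equivalent to orthonormality, and it is literally the POVM condition for the rank-one
  projections.\<close>

definition frame :: "nat \<Rightarrow> (nat \<Rightarrow> nat \<Rightarrow> complex) \<Rightarrow> bool" where
  "frame n v \<longleftrightarrow> (\<forall>k<n. \<forall>l<n. (\<Sum>j<n. v j k * cnj (v j l)) = (if k = l then 1 else 0))"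

lemma sform_cnj:
  assumes "hermitian_array Z"
  shows "sform n Z w v = cnj (sform n Z v w)"
proof -
  have "sform n Z w v = (\<Sum>l<n. \<Sum>k<n. cnj (w k) * Z k l * v l)"
    unfolding sform_def by (rule sum.swap)
  also have "\<dots> = cnj (sform n Z v w)"
    using assms unfolding sform_def hermitian_array_def cnj_sum
    by (intro sum.cong refl) (metis complex_cnj_cnj complex_cnj_mult mult.assoc mult.commute)
  finally show ?thesis .
qed

lemma sform_combine:
  "sform n Z (\<lambda>k. a * x k + b * y k) (\<lambda>k. a * x k + b * y k) =
     cnj a * a * sform n Z x x + cnj b * b * sform n Z y y
     + cnj a * b * sform n Z x y + cnj b * a * sform n Z y x"
  unfolding sform_def sum_distrib_left sum.distrib[symmetric]
  by (intro sum.cong refl) (simp add: algebra_simps)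

text \<open>Invariance of the trace under change of orthonormal basis. For traceless
  \<open>Z\<close> it yields values of both signs, and it determines the last value once the others
  are known.\<close>

lemma sform_frame_sum:
  assumes "frame n v"
  shows "(\<Sum>j<n. sform n Z (v j) (v j)) = (\<Sum>k<n. Z k k)"
proof -
  have "(\<Sum>j<n. sform n Z (v j) (v j)) = (\<Sum>k<n. \<Sum>j<n. \<Sum>l<n. cnj (v j k) * Z k l * v j l)"
    unfolding sform_def by (rule sum.swap)
  also have "\<dots> = (\<Sum>k<n. \<Sum>l<n. \<Sum>j<n. cnj (v j k) * Z k l * v j l)"
    by (intro sum.cong refl sum.swap)
  also have "\<dots> = (\<Sum>k<n. \<Sum>l<n. Z k l * (\<Sum>j<n. v j l * cnj (v j k)))"
    by (simp add: sum_distrib_left mult_ac)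
  also have "\<dots> = (\<Sum>k<n. \<Sum>l<n. Z k l * (if l = k then 1 else 0))"
    using assms by (intro sum.cong refl) (auto simp: frame_def)
  also have "\<dots> = (\<Sum>k<n. Z k k)"
    by (intro sum.cong refl) (simp add: if_distrib cong: if_cong)
  finally show ?thesis .
qed

lemma frame_standard: "frame n (\<lambda>j k. if j = k then 1 else 0)"
proof -
  have "(\<Sum>j<n. (if j = k then 1 else 0) * cnj (if j = l then 1 else 0)) = (if k = l then 1 else 0)"
    if "k < n" for k l
  proof -
    have "(\<Sum>j<n. (if j = k then 1 else 0) * cnj (if j = l then 1 else 0))
        = (\<Sum>j<n. if j = k then (if k = l then 1 else (0::complex)) else 0)"
      by (intro sum.cong refl) auto
    then show ?thesis using that by simp
  qed
  then show ?thesis by (simp add: frame_def)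
qed

text \<open>Used with \<open>g\<close> the (k, l) entry of |v><v|: exchanging two vectors for a
  rotated pair with the same sum of projections keeps the frame property.\<close>

lemma sum_update_pair:
  fixes g :: "'b \<Rightarrow> 'c::comm_monoid_add"
  assumes "i < (n::nat)" "i' < n" "i \<noteq> i'" and "g w + g w' = g (v i) + g (v i')"
  shows "(\<Sum>j<n. g ((v(i := w, i' := w')) j)) = (\<Sum>j<n. g (v j))"
proof -
  have split: "(\<Sum>j<n. h j) = (h i + h i') + (\<Sum>j\<in>{..<n} - {i} - {i'}. h j)" for h :: "nat \<Rightarrow> 'c"
    using assms(1-3) sum.remove[of "{..<n}" i h] sum.remove[of "{..<n} - {i}" i' h]
    by (simp add: add.assoc)
  have "(\<Sum>j\<in>{..<n} - {i} - {i'}. g ((v(i := w, i' := w')) j)) = (\<Sum>j\<in>{..<n} - {i} - {i'}. g (v j))"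
    by (intro sum.cong refl) auto
  then show ?thesis
    unfolding split using assms(3,4) by simp
qed

text \<open>The factor \<open>\<i> * cnj z / cmod z\<close> turns \<open>z\<close> into
  \<open>\<i>\<close> times its modulus, a purely imaginary number.\<close>

lemma exists_phase: "\<exists>u. cmod u = 1 \<and> Re (u * z) = 0"
proof (cases "z = 0")
  case True
  then show ?thesis by (intro exI[of _ 1]) simp
next
  case False
  have "Re (\<i> * cnj z / cmod z * z) = Re (\<i> * (z * cnj z) / cmod z)"
    by (simp add: mult_ac)
  also have "\<dots> = 0"
    by (simp only: complex_norm_square[symmetric]) simp
  finally show ?thesis using False
    by (intro exI[of _ "\<i> * cnj z / cmod z"]) (simp add: norm_mult norm_divide)
qed

text \<open>Dividing by \<open>t^2\<close> leaves a quadratic in the ratio c / t, whose reduced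
  discriminant \<open>r^2 - p * q\<close> is positive because \<open>p\<close> and \<open>q\<close>
  have opposite signs. Here \<open>\<tau>\<close> is a root, and \<open>k\<close> normalises the
  pair to the unit circle.\<close>

lemma indefinite_quadratic_root:
  fixes p q r :: real
  assumes "p > 0" "q < 0"
  shows "\<exists>c t. c^2 + t^2 = 1 \<and> c^2 * p + t^2 * q + 2 * c * t * r = 0"
proof -
  define D where "D = sqrt (r^2 - p * q)"
  define \<tau> where "\<tau> = (D - r) / p"
  define k where "k = 1 / sqrt (1 + \<tau>^2)"
  have "p * q \<le> 0" using assms by (simp add: mult_nonneg_nonpos)
  then have "r^2 - p * q \<ge> 0" using zero_le_power2[of r] by linarith
  then have D2: "D^2 = r^2 - p * q" unfolding D_def by simp
  have pt: "p * \<tau> = D - r" using assms by (simp add: \<tau>_def)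
  have "p * (p * \<tau>^2 + 2 * r * \<tau> + q) = (p * \<tau>)^2 + 2 * r * (p * \<tau>) + p * q"
    by (simp add: power2_eq_square algebra_simps)
  also have "\<dots> = 0" unfolding pt using D2 by (simp add: power2_eq_square algebra_simps)
  finally have root: "p * \<tau>^2 + 2 * r * \<tau> + q = 0" using assms by simp
  have pos: "1 + \<tau>^2 > 0" using zero_le_power2[of \<tau>] by linarith
  have k2: "k^2 * (1 + \<tau>^2) = 1" using pos by (simp add: k_def power_divide)
  have "(k * \<tau>)^2 + k^2 = 1" using k2 by (simp add: power_mult_distrib algebra_simps)
  moreover have "(k * \<tau>)^2 * p + k^2 * q + 2 * (k * \<tau>) * k * r = k^2 * (p * \<tau>^2 + 2 * r * \<tau> + q)"
    by (simp add: power2_eq_square algebra_simps)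
  ultimately show ?thesis using root by (intro exI[of _ "k * \<tau>"] exI[of _ k]) simp
qed

lemma sform_hermitian_real:
  assumes "hermitian_array Z"
  shows "sform n Z v v = of_real (Re (sform n Z v v))"
  using sform_cnj[OF assms, of n v v] by (metis Reals_cnj_iff of_real_Re)

(* The phase of the coefficient of y kills the cross term of X; its size then solves a real
   quadratic equation for Y. *)
lemma simultaneous_isotropic_rotation:
  assumes "hermitian_array X" "hermitian_array Y"
    and "sform n X x x = 0" "sform n X y y = 0"
    and "Re (sform n Y x x) > 0" "Re (sform n Y y y) < 0"
  shows "\<exists>a b. cnj a * a + cnj b * b = 1 \<and> cnj a = a \<and>
    sform n X (\<lambda>k. a * x k + b * y k) (\<lambda>k. a * x k + b * y k) = 0 \<and>
    sform n Y (\<lambda>k. a * x k + b * y k) (\<lambda>k. a * x k + b * y k) = 0"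
proof -
  obtain u where u: "cmod u = 1" "Re (u * sform n X x y) = 0" using exists_phase by blast
  obtain c t where ct: "c^2 + t^2 = 1"
    "c^2 * Re (sform n Y x x) + t^2 * Re (sform n Y y y) + 2 * c * t * Re (u * sform n Y x y) = 0"
    using indefinite_quadratic_root[OF assms(5,6)] by blast
  define a where "a = complex_of_real c"
  define b where "b = of_real t * u"
  have uu: "cnj u * u = 1" using u(1) complex_norm_square[of u] by (simp add: mult.commute)
  have aa: "cnj a * a = of_real (c^2)" by (simp add: a_def power2_eq_square)
  have bb: "cnj b * b = of_real (t^2)"
  proof -
    have "cnj b * b = of_real t * of_real t * (cnj u * u)" by (simp add: b_def)
    then show ?thesis using uu by (simp add: power2_eq_square)
  qed
  have val: "sform n H (\<lambda>k. a * x k + b * y k) (\<lambda>k. a * x k + b * y k) =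
     of_real (c^2 * Re (sform n H x x) + t^2 * Re (sform n H y y) + 2 * c * t * Re (u * sform n H x y))"
    if H: "hermitian_array H" for H
  proof -
    \<comment> \<open>Hermiticity makes the two cross terms conjugate, so only the real part of
      \<open>u * sform n H x y\<close> survives.\<close>
    have "cnj a * b * sform n H x y + cnj b * a * sform n H y x
      = of_real (c * t) * (u * sform n H x y + cnj (u * sform n H x y))"
      by (subst sform_cnj[OF H, of n y x]) (simp add: a_def b_def algebra_simps)
    also have "\<dots> = of_real (2 * c * t * Re (u * sform n H x y))"
      by (simp only: complex_add_cnj) simp
    finally have "cnj a * b * sform n H x y + cnj b * a * sform n H y x
      = of_real (2 * c * t * Re (u * sform n H x y))" .
    then show ?thesis
      unfolding sform_combine aa bb
      using sform_hermitian_real[OF H, of n x] sform_hermitian_real[OF H, of n y]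
      by (metis (no_types, lifting) add.assoc of_real_add of_real_mult)
  qed
  show ?thesis
  proof (intro exI conjI)
    show "cnj a * a + cnj b * b = 1"
      unfolding aa bb using ct(1) by (metis of_real_1 of_real_add)
    show "cnj a = a" by (simp add: a_def)
    show "sform n X (\<lambda>k. a * x k + b * y k) (\<lambda>k. a * x k + b * y k) = 0"
      unfolding val[OF assms(1)] using assms(3,4) u(2) by simp
    show "sform n Y (\<lambda>k. a * x k + b * y k) (\<lambda>k. a * x k + b * y k) = 0"
      unfolding val[OF assms(2)] using ct(2) by simp
  qed
qed

lemma exists_opposite_signs:
  fixes f :: "nat \<Rightarrow> real"
  assumes "(\<Sum>j<n. f j) = 0" and "\<exists>j<n. f j \<noteq> 0"
  shows "\<exists>i<n. \<exists>i'<n. f i > 0 \<and> f i' < 0"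
proof -
  have "\<exists>i<n. f i > 0"
    using assms sum_nonneg_eq_0_iff[of "{..<n}" "\<lambda>j. - f j"] by (force simp: sum_negf not_less)
  moreover have "\<exists>i<n. f i < 0"
    using assms sum_nonneg_eq_0_iff[of "{..<n}" f] by (force simp: not_less)
  ultimately show ?thesis by blast
qed

text \<open>Induction on the number of frame vectors with nonzero \<open>Y\<close>-value. These
  values are real with sum 0, so a positive and a negative one exist; rotating their plane makes one
  vector of the pair isotropic for both forms and leaves all other vectors untouched.\<close>

lemma frame_isotropic_improve:
  assumes X: "hermitian_array X" "(\<Sum>k<n. X k k) = 0"
    and Y: "hermitian_array Y" "(\<Sum>k<n. Y k k) = 0"
    and "frame n v" "\<And>j. j < n \<Longrightarrow> sform n X (v j) (v j) = 0"
  shows "\<exists>v. frame n v \<and> (\<forall>j<n. sform n X (v j) (v j) = 0 \<and> sform n Y (v j) (v j) = 0)"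
  using assms(5,6)
proof (induction "card {j. j < n \<and> sform n Y (v j) (v j) \<noteq> 0}" arbitrary: v rule: less_induct)
  case less
  let ?f = "\<lambda>j. Re (sform n Y (v j) (v j))"
  have f: "sform n Y (v j) (v j) = of_real (?f j)" for j
    using sform_hermitian_real[OF Y(1)] .
  show ?case
  proof (cases "\<exists>j<n. ?f j \<noteq> 0")
    case False
    then have "\<forall>j<n. sform n Y (v j) (v j) = 0" using f by (metis of_real_0)
    then show ?thesis using less.prems by blast
  next
    case True
    have "(\<Sum>j<n. ?f j) = 0"
      using sform_frame_sum[OF less.prems(1), of Y] Y(2) by (metis Re_sum zero_complex.sel(1))
    then obtain i i' where i: "i < n" "i' < n" "?f i > 0" "?f i' < 0"
      using exists_opposite_signs True by blast
    then have ne: "i \<noteq> i'" by auto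
    obtain a b where ab: "cnj a * a + cnj b * b = 1" "cnj a = a"
      "sform n X (\<lambda>k. a * v i k + b * v i' k) (\<lambda>k. a * v i k + b * v i' k) = 0"
      "sform n Y (\<lambda>k. a * v i k + b * v i' k) (\<lambda>k. a * v i k + b * v i' k) = 0"
      using simultaneous_isotropic_rotation[OF X(1) Y(1) less.prems(2)[OF i(1)] less.prems(2)[OF i(2)] i(3,4)]
      by blast
    define w where "w = (\<lambda>k. a * v i k + b * v i' k)"
    \<comment> \<open>The second row of the unitary matrix with first row (a, b); it has this form
      because \<open>a\<close> is real.\<close>
    define w' where "w' = (\<lambda>k. - cnj b * v i k + a * v i' k)"
    define v' where "v' = v(i := w, i' := w')"
    have "w k * cnj (w l) + w' k * cnj (w' l) = v i k * cnj (v i l) + v i' k * cnj (v i' l)" for k l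
    proof -
      have "w k * cnj (w l) + w' k * cnj (w' l)
        = (cnj a * a + cnj b * b) * (v i k * cnj (v i l) + v i' k * cnj (v i' l))"
        unfolding w_def w'_def by (simp add: ab(2)) (simp add: algebra_simps)
      then show ?thesis using ab(1) by simp
    qed
    then have fr: "frame n v'"
      using less.prems(1) sum_update_pair[OF i(1,2) ne, of "\<lambda>v. v k * cnj (v l)" w w' v for k l]
      unfolding frame_def v'_def by simp
    \<comment> \<open>No computation with \<open>w'\<close>: its \<open>X\<close>-value is the only
      one left in a sum equal to the trace of \<open>X\<close>, which is 0.\<close>
    have Xw': "sform n X w' w' = 0"
    proof -
      have "(\<Sum>j<n. sform n X (v' j) (v' j)) = (\<Sum>j<n. if j = i' then sform n X w' w' else 0)"
        using less.prems(2) ab(3) by (intro sum.cong refl) (auto simp: v'_def w_def)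
      then show ?thesis using sform_frame_sum[OF fr, of X] X(2) i(2) by simp
    qed
    have X0: "\<And>j. j < n \<Longrightarrow> sform n X (v' j) (v' j) = 0"
      using Xw' less.prems(2) ab(3) by (auto simp: v'_def w_def)
    have "{j. j < n \<and> sform n Y (v' j) (v' j) \<noteq> 0} \<subset> {j. j < n \<and> sform n Y (v j) (v j) \<noteq> 0}"
    proof (intro psubsetI subsetI)
      fix j assume j: "j \<in> {j. j < n \<and> sform n Y (v' j) (v' j) \<noteq> 0}"
      then have "j \<noteq> i" using ab(4) ne by (auto simp: v'_def w_def)
      \<comment> \<open>The \<open>Y\<close>-value of \<open>w'\<close> is not controlled, but index
        \<open>i'\<close> was already counted, so the count still drops because \<open>i\<close>
        leaves.\<close>
      then show "j \<in> {j. j < n \<and> sform n Y (v j) (v j) \<noteq> 0}"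
        using j i by (cases "j = i'") (auto simp: v'_def)
    next
      have "i \<notin> {j. j < n \<and> sform n Y (v' j) (v' j) \<noteq> 0}"
        using ab(4) ne by (auto simp: v'_def w_def)
      moreover have "i \<in> {j. j < n \<and> sform n Y (v j) (v j) \<noteq> 0}" using i by auto
      ultimately show "{j. j < n \<and> sform n Y (v' j) (v' j) \<noteq> 0} \<noteq> {j. j < n \<and> sform n Y (v j) (v j) \<noteq> 0}"
        by blast
    qed
    then have "card {j. j < n \<and> sform n Y (v' j) (v' j) \<noteq> 0} < card {j. j < n \<and> sform n Y (v j) (v j) \<noteq> 0}"
      by (intro psubset_card_mono) auto
    from less.hyps[OF this fr X0] show ?thesis .
  qed
qed

lemma traceless_isotropic_frame:
  assumes "(\<Sum>k<n. Z k k) = 0"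
  shows "\<exists>v. frame n v \<and> (\<forall>j<n. sform n Z (v j) (v j) = 0)"
proof -
  define X where "X = (\<lambda>k l. Z k l + cnj (Z l k))"
  define Y where "Y = (\<lambda>k l. \<i> * (Z k l - cnj (Z l k)))"
  have herm: "hermitian_array X" "hermitian_array Y" "hermitian_array (\<lambda>_ _. 0)"
    by (auto simp: hermitian_array_def X_def Y_def algebra_simps)
  have "(\<Sum>k<n. cnj (Z k k)) = 0" using assms by (metis cnj_sum complex_cnj_zero)
  then have tr: "(\<Sum>k<n. X k k) = 0" "(\<Sum>k<n. Y k k) = 0"
    using assms by (simp_all add: X_def Y_def sum.distrib sum_subtractf sum_distrib_left[symmetric])
  \<comment> \<open>First pass: the zero array stands for the form already handled, so the standard
    basis can serve as the start.\<close>
  obtain v where "frame n v" "\<forall>j<n. sform n X (v j) (v j) = 0"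
    using frame_isotropic_improve[OF herm(3) _ herm(1) tr(1) frame_standard]
    by (auto simp: sform_def)
  then obtain v where v: "frame n v" "\<forall>j<n. sform n X (v j) (v j) = 0 \<and> sform n Y (v j) (v j) = 0"
    using frame_isotropic_improve[OF herm(1) tr(1) herm(2) tr(2)] by blast
  have "2 * sform n Z v v = sform n X v v - \<i> * sform n Y v v" for v
    unfolding sform_def sum_distrib_left sum_subtractf[symmetric]
    by (intro sum.cong refl) (simp add: X_def Y_def algebra_simps)
  then have "\<forall>j<n. sform n Z (v j) (v j) = 0"
    using v(2) by (metis diff_0_right mult_eq_0_iff mult_zero_right zero_neq_numeral)
  then show ?thesis using v(1) by blast
qed

section \<open>Positive semidefinite matrices and Kronecker products\<close>

definition quad :: "complex mat \<Rightarrow> (nat \<Rightarrow> complex) \<Rightarrow> complex" where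
  "quad M f = sform (dim_row M) (\<lambda>k l. M $$ (k, l)) f f"

text \<open>Passes from the traces in the definition of distinguishability to the quadratic forms
  used everywhere below.\<close>

lemma mat_trace_ket_bra:
  assumes "M \<in> carrier_mat n n" "\<psi> \<in> carrier_vec n"
  shows "mat_trace (M * ket_bra \<psi>) = quad M (\<lambda>k. \<psi> $ k)"
proof -
  have "mat_trace (M * ket_bra \<psi>) = (\<Sum>i<n. \<Sum>l<n. M $$ (i, l) * (\<psi> $ l * cnj (\<psi> $ i)))"
    using assms unfolding mat_trace_def
    by (auto simp: ket_bra_def scalar_prod_def atLeast0LessThan intro!: sum.cong)
  then show ?thesis
    using assms by (simp add: quad_def sform_def mult_ac)
qed

lemma mat_adjoint_index:
  assumes "A \<in> carrier_mat n n" "i < n" "j < n"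
  shows "mat_adjoint A $$ (i, j) = cnj (A $$ (j, i))"
  using assms by (simp add: mat_adjoint_def mat_of_rows_def)

lemma mult_mat_vec_cscalar:
  assumes "A \<in> carrier_mat n n"
  shows "(A *\<^sub>v vec n f) \<bullet>c vec n f = quad A f"
proof -
  have "(A *\<^sub>v vec n f) \<bullet>c vec n f = (\<Sum>k<n. (\<Sum>l<n. A $$ (k, l) * f l) * cnj (f k))"
    using assms by (auto simp: scalar_prod_def atLeast0LessThan intro!: sum.cong)
  also have "\<dots> = (\<Sum>k<n. \<Sum>l<n. cnj (f k) * A $$ (k, l) * f l)"
    unfolding sum_distrib_right by (intro sum.cong refl) (simp add: mult_ac)
  finally show ?thesis using assms by (simp add: quad_def sform_def)
qed

lemma psd_iff_quad:
  "psd n A \<longleftrightarrow> A \<in> carrier_mat n n \<and> (\<forall>i<n. \<forall>j<n. A $$ (j, i) = cnj (A $$ (i, j))) \<and> (\<forall>f. 0 \<le> quad A f)"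
proof (cases "A \<in> carrier_mat n n")
  case True
  have "mat_adjoint A = A \<longleftrightarrow> (\<forall>i<n. \<forall>j<n. A $$ (j, i) = cnj (A $$ (i, j)))"
  proof
    assume "mat_adjoint A = A"
    then show "\<forall>i<n. \<forall>j<n. A $$ (j, i) = cnj (A $$ (i, j))"
      using mat_adjoint_index[OF True] by metis
  next
    assume *: "\<forall>i<n. \<forall>j<n. A $$ (j, i) = cnj (A $$ (i, j))"
    show "mat_adjoint A = A"
    proof (rule eq_matI)
      fix i j assume "i < dim_row A" "j < dim_col A"
      then show "mat_adjoint A $$ (i, j) = A $$ (i, j)"
        using True mat_adjoint_index[OF True, of i j] *[rule_format, of j i] by simp
    qed (use True in \<open>simp_all add: mat_adjoint_def\<close>)
  qed
  moreover have "(\<forall>v \<in> carrier_vec n. 0 \<le> (A *\<^sub>v v) \<bullet>c v) \<longleftrightarrow> (\<forall>f. 0 \<le> quad A f)"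
  proof
    assume *: "\<forall>v \<in> carrier_vec n. 0 \<le> (A *\<^sub>v v) \<bullet>c v"
    show "\<forall>f. 0 \<le> quad A f"
      using * by (metis mult_mat_vec_cscalar[OF True] vec_carrier)
  next
    assume *: "\<forall>f. 0 \<le> quad A f"
    show "\<forall>v \<in> carrier_vec n. 0 \<le> (A *\<^sub>v v) \<bullet>c v"
    proof
      fix v :: "complex vec" assume "v \<in> carrier_vec n"
      then have "v = vec n (\<lambda>k. v $ k)" by auto
      then show "0 \<le> (A *\<^sub>v v) \<bullet>c v"
        using * mult_mat_vec_cscalar[OF True, of "\<lambda>k. v $ k"] by simp
    qed
  qed
  ultimately show ?thesis using True by (simp add: psd_def)
qed (simp add: psd_def)

text \<open>Probes the principal submatrix on \<open>p\<close> and \<open>q\<close>, both for the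
  minor inequality and for Bell states. The case \<open>p = q\<close> is allowed and gives diagonal
  entries.\<close>

lemma quad_two_point:
  assumes "M \<in> carrier_mat n n" "p < n" "q < n"
  shows "quad M (\<lambda>k. a * of_bool (k = p) + b * of_bool (k = q)) =
    cnj a * a * M $$ (p, p) + cnj b * b * M $$ (q, q) + cnj a * b * M $$ (p, q) + cnj b * a * M $$ (q, p)"
proof -
  have delta: "sform n Z (\<lambda>k. of_bool (k = p)) (\<lambda>k. of_bool (k = q)) = Z p q"
    if "p < n" "q < n" for Z p q
  proof -
    have "sform n Z (\<lambda>k. of_bool (k = p)) (\<lambda>k. of_bool (k = q))
        = (\<Sum>k<n. if k = p then \<Sum>l<n. if l = q then Z p q else 0 else 0)"
      unfolding sform_def by (intro sum.cong refl) (auto intro!: sum.cong)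
    then show ?thesis using that by simp
  qed
  show ?thesis
    using assms unfolding quad_def sform_combine by (simp add: delta)
qed

lemma psd_diag:
  assumes "psd n A" "i < n"
  shows "Im (A $$ (i, i)) = 0" "Re (A $$ (i, i)) \<ge> 0"
proof -
  have "0 \<le> quad A (\<lambda>k. 1 * of_bool (k = i) + 0 * of_bool (k = i))"
    using assms(1) unfolding psd_iff_quad by blast
  also have "\<dots> = A $$ (i, i)"
    using assms quad_two_point[of A n i i 1 0] by (simp add: psd_def)
  finally show "Im (A $$ (i, i)) = 0" "Re (A $$ (i, i)) \<ge> 0" by (auto simp: less_eq_complex_def)
qed

lemma psd_minor:
  assumes "psd n A" "i < n" "j < n"
  shows "(cmod (A $$ (i, j)))^2 \<le> Re (A $$ (i, i)) * Re (A $$ (j, j))"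
proof -
  define z p q where "z = A $$ (i, j)" and "p = Re (A $$ (i, i))" and "q = Re (A $$ (j, j))"
  have car: "A \<in> carrier_mat n n" and ji: "A $$ (j, i) = cnj z"
    using assms unfolding psd_iff_quad z_def by blast+
  have pq: "A $$ (i, i) = of_real p" "A $$ (j, j) = of_real q" "p \<ge> 0" "q \<ge> 0"
    using psd_diag[OF assms(1)] assms(2,3) by (auto simp: p_def q_def complex_eq_iff)
  \<comment> \<open>The test vector t e_i - s conj(z) e_j, whose phase makes the cross terms real
    and negative when t and s are positive.\<close>
  have form: "0 \<le> t^2 * p + s^2 * (cmod z)^2 * q - 2 * t * s * (cmod z)^2" for t s :: real
  proof -
    have "quad A (\<lambda>k. of_real t * of_bool (k = i) + (- of_real s * cnj z) * of_bool (k = j))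
      = of_real (t^2 * p) + of_real (s^2 * q) * (z * cnj z) - of_real (2 * t * s) * (z * cnj z)"
      unfolding quad_two_point[OF car assms(2,3)] ji pq z_def[symmetric]
      by (simp add: power2_eq_square algebra_simps)
    also have "\<dots> = of_real (t^2 * p + s^2 * (cmod z)^2 * q - 2 * t * s * (cmod z)^2)"
      unfolding complex_norm_square[symmetric] by (simp add: algebra_simps)
    finally have eq: "quad A (\<lambda>k. of_real t * of_bool (k = i) + (- of_real s * cnj z) * of_bool (k = j))
      = of_real (t^2 * p + s^2 * (cmod z)^2 * q - 2 * t * s * (cmod z)^2)" .
    have "0 \<le> quad A (\<lambda>k. of_real t * of_bool (k = i) + (- of_real s * cnj z) * of_bool (k = j))"
      using assms(1) unfolding psd_iff_quad by blast
    then show ?thesis unfolding eq less_eq_complex_def Re_complex_of_real by simp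
  qed
  show ?thesis
  proof (cases "q = 0")
    case False
    \<comment> \<open>The choice t = q, s = 1 gives \<open>q\<close> times the determinant of the 2
      x 2 minor.\<close>
    have "0 \<le> q * (q * p - (cmod z)^2)"
      using form[of q 1] by (simp add: power2_eq_square algebra_simps)
    then have "0 \<le> q * p - (cmod z)^2"
      using False pq(4) by (simp add: zero_le_mult_iff)
    then show ?thesis by (simp add: z_def p_def q_def mult.commute)
  next
    case True
    have "z = 0"
    proof (rule ccontr)
      assume "z \<noteq> 0"
      \<comment> \<open>With q = 0 the form is linear in s; this s gives the value p - 2 (p + 1),
        which is negative.\<close>
      then show False
        using form[of 1 "(p + 1) / (cmod z)^2"] True pq(3) by simp
    qed
    then show ?thesis using pq(3,4) by (simp add: z_def[symmetric] p_def[symmetric] q_def[symmetric])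
  qed
qed

definition rank_one :: "nat \<Rightarrow> (nat \<Rightarrow> complex) \<Rightarrow> complex mat" where
  "rank_one n v = mat n n (\<lambda>(k, l). v k * cnj (v l))"

lemma psd_rank_one: "psd n (rank_one n v)"
proof -
  have "0 \<le> quad (rank_one n v) f" for f
  proof -
    have "quad (rank_one n v) f = (\<Sum>k<n. cnj (f k) * v k) * (\<Sum>l<n. cnj (v l) * f l)"
      unfolding quad_def sform_def sum_product
      by (simp add: rank_one_def mult_ac)
    also have "\<dots> = cnj (\<Sum>l<n. cnj (v l) * f l) * (\<Sum>l<n. cnj (v l) * f l)"
      by (simp add: mult_ac)
    also have "\<dots> = of_real ((cmod (\<Sum>l<n. cnj (v l) * f l))^2)"
      by (simp only: complex_norm_square mult.commute)
    finally show ?thesis by (simp add: less_eq_complex_def)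
  qed
  then show ?thesis by (auto simp: psd_iff_quad rank_one_def)
qed

lemma povm_frame:
  assumes "frame n v"
  shows "povm n {..<n} (\<lambda>j. rank_one n (v j))"
  using assms psd_rank_one unfolding povm_def frame_def
  by (auto simp: rank_one_def intro!: eq_matI)

section \<open>Kronecker products in block coordinates\<close>

lemma sum_lessThan_mult:
  fixes f :: "nat \<Rightarrow> 'a::comm_monoid_add"
  shows "(\<Sum>x<m * n. f x) = (\<Sum>i<m. \<Sum>k<n. f (i * n + k))"
proof -
  have "(\<Sum>x<m * n. f x) = (\<Sum>i<m. sum f {i * n..<i * n + n})"
    by (simp add: sum.nat_group mult.commute)
  also have "\<dots> = (\<Sum>i<m. \<Sum>k<n. f (i * n + k))"
  proof (rule sum.cong[OF refl])
    show "sum f {i * n..<i * n + n} = (\<Sum>k<n. f (i * n + k))" for i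
      using sum.shift_bounds_nat_ivl[of f 0 "i * n" n] by (simp add: atLeast0LessThan add.commute)
  qed
  finally show ?thesis .
qed

lemma mult_add_less:
  fixes i k m n :: nat
  assumes "i < m" "k < n"
  shows "i * n + k < m * n"
proof -
  have "i * n + k < Suc i * n" using assms by simp
  also have "\<dots> \<le> m * n" using assms by (intro mult_le_mono1) simp
  finally show ?thesis .
qed

lemma kron_carrier:
  "A \<in> carrier_mat m m \<Longrightarrow> B \<in> carrier_mat n n \<Longrightarrow> kron A B \<in> carrier_mat (m * n) (m * n)"
  by (auto simp: kron_def)

lemma kron_index:
  assumes "A \<in> carrier_mat m m" "B \<in> carrier_mat n n" "i < m" "j < m" "k < n" "l < n"
  shows "kron A B $$ (i * n + k, j * n + l) = A $$ (i, j) * B $$ (k, l)"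
  using assms mult_add_less[of i m k n] mult_add_less[of j m l n] by (auto simp: kron_def)

text \<open>Contracting \<open>f\<close> with \<open>v\<close> on the first factor leaves the
  unnormalised conditional vector of the second factor. This is what lets the first party be split
  off in the induction.\<close>

lemma quad_kron_rank_one:
  assumes "B \<in> carrier_mat n n"
  shows "quad (kron (rank_one m v) B) f = quad B (\<lambda>k. \<Sum>i<m. cnj (v i) * f (i * n + k))"
proof -
  have car: "rank_one m v \<in> carrier_mat m m" by (simp add: rank_one_def)
  then have dim: "dim_row (kron (rank_one m v) B) = m * n" using kron_carrier assms by blast
  have "quad (kron (rank_one m v) B) f
     = (\<Sum>i<m. \<Sum>k<n. \<Sum>j<m. \<Sum>l<n. cnj (f (i * n + k)) * (v i * cnj (v j) * B $$ (k, l)) * f (j * n + l))"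
    unfolding quad_def sform_def dim sum_lessThan_mult
    using kron_index[OF car assms]
    by (intro sum.cong refl) (simp add: rank_one_def[of m v, THEN arg_cong, of "\<lambda>A. A $$ _"])
  \<comment> \<open>The indices i, j of the first factor move inside, where the sum over them
    factorises for fixed k, l.\<close>
  also have "\<dots> = (\<Sum>k<n. \<Sum>i<m. \<Sum>l<n. \<Sum>j<m. cnj (f (i * n + k)) * (v i * cnj (v j) * B $$ (k, l)) * f (j * n + l))"
    by (subst sum.swap) (intro sum.cong refl sum.swap)
  also have "\<dots> = (\<Sum>k<n. \<Sum>l<n. \<Sum>i<m. \<Sum>j<m. cnj (f (i * n + k)) * (v i * cnj (v j) * B $$ (k, l)) * f (j * n + l))"
    by (intro sum.cong refl sum.swap)
  also have "\<dots> = (\<Sum>k<n. \<Sum>l<n. cnj (\<Sum>i<m. cnj (v i) * f (i * n + k)) * B $$ (k, l) * (\<Sum>j<m. cnj (v j) * f (j * n + l)))"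
  proof (rule sum.cong[OF refl], rule sum.cong[OF refl])
    show "(\<Sum>i<m. \<Sum>j<m. cnj (f (i * n + k)) * (v i * cnj (v j) * B $$ (k, l)) * f (j * n + l))
        = cnj (\<Sum>i<m. cnj (v i) * f (i * n + k)) * B $$ (k, l) * (\<Sum>j<m. cnj (v j) * f (j * n + l))" for k l
    proof -
      have "cnj (\<Sum>i<m. cnj (v i) * f (i * n + k)) * B $$ (k, l) * (\<Sum>j<m. cnj (v j) * f (j * n + l))
        = B $$ (k, l) * ((\<Sum>i<m. v i * cnj (f (i * n + k))) * (\<Sum>j<m. cnj (v j) * f (j * n + l)))"
        by simp
      also have "\<dots> = (\<Sum>i<m. \<Sum>j<m. B $$ (k, l) * (v i * cnj (f (i * n + k)) * (cnj (v j) * f (j * n + l))))"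
        by (subst sum_product) (simp only: sum_distrib_left)
      finally show ?thesis by (simp add: mult_ac)
    qed
  qed
  finally show ?thesis using assms by (simp add: quad_def sform_def)
qed

section \<open>Adaptive measurements\<close>

text \<open>The POVM clause of \<open>locc1_povm\<close> with the protocol as explicit parameters,
  so that inductions on \<open>K\<close> can shift to the protocol that follows a first
  outcome.\<close>

definition adaptive :: "nat \<Rightarrow> (nat \<Rightarrow> nat) \<Rightarrow> (nat list \<Rightarrow> nat set) \<Rightarrow> (nat list \<Rightarrow> nat \<Rightarrow> complex mat) \<Rightarrow> bool" where
  "adaptive K d out A \<longleftrightarrow> (\<forall>s<K. \<forall>js \<in> records out s. povm (d s) (out js) (A js))"

definition locc_op :: "nat \<Rightarrow> (nat list \<Rightarrow> nat \<Rightarrow> complex mat) \<Rightarrow> nat list \<Rightarrow> complex mat" where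
  "locc_op K A js = tensor (map (\<lambda>s. A (take s js) (js ! s)) [0..<K])"

lemma records_0 [simp]: "records out 0 = {[]}"
  by (auto simp: records_def)

lemma Cons_in_records_Suc [simp]:
  "j # js \<in> records out (Suc s) \<longleftrightarrow> j \<in> out [] \<and> js \<in> records (\<lambda>js. out (j # js)) s"
  by (auto simp: records_def less_Suc_eq_0_disj)

lemma records_Suc:
  "records out (Suc s) = (\<Union>j\<in>out []. (#) j ` records (\<lambda>js. out (j # js)) s)"
proof (intro equalityI subsetI)
  fix js assume js: "js \<in> records out (Suc s)"
  then obtain j js' where "js = j # js'"
    by (cases js) (auto simp: records_def)
  then show "js \<in> (\<Union>j\<in>out []. (#) j ` records (\<lambda>js. out (j # js)) s)" using js by auto
qed auto

lemma adaptive_0 [simp]: "adaptive 0 d out A"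
  by (simp add: adaptive_def)

text \<open>Splits off the first party: after outcome \<open>j\<close>, prefixing records by
  \<open>j\<close> and shifting \<open>d\<close> gives an adaptive measurement of the remaining
  parties. The inductions over \<open>K\<close> rest on this.\<close>

lemma adaptive_Suc:
  "adaptive (Suc K) d out A \<longleftrightarrow> povm (d 0) (out []) (A []) \<and>
     (\<forall>j\<in>out []. adaptive K (\<lambda>k. d (Suc k)) (\<lambda>js. out (j # js)) (\<lambda>js. A (j # js)))"
  unfolding adaptive_def All_less_Suc2 records_Suc by auto

lemma locc_op_0 [simp]: "locc_op 0 A js = 1\<^sub>m 1"
  by (simp add: locc_op_def tensor_def)

lemma locc_op_Suc [simp]: "locc_op (Suc K) A (j # js) = kron (A [] j) (locc_op K (\<lambda>js. A (j # js)) js)"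
  unfolding locc_op_def tensor_def map_upt_Suc by simp

lemma sys_dim_0 [simp]: "sys_dim 0 d = 1"
  by (simp add: sys_dim_def)

lemma sys_dim_Suc: "sys_dim (Suc K) d = d 0 * sys_dim K (\<lambda>k. d (Suc k))"
  unfolding sys_dim_def by (rule prod.lessThan_Suc_shift)

lemma adaptive_psd:
  "adaptive (Suc K) d out A \<Longrightarrow> j \<in> out [] \<Longrightarrow> psd (d 0) (A [] j)"
  by (simp add: adaptive_Suc povm_def)

lemma locc_op_carrier:
  "adaptive K d out A \<Longrightarrow> js \<in> records out K \<Longrightarrow> locc_op K A js \<in> carrier_mat (sys_dim K d) (sys_dim K d)"
proof (induction K arbitrary: d out A js)
  case (Suc K)
  from Suc.prems(2) obtain j js' where js: "js = j # js'" "j \<in> out []" "js' \<in> records (\<lambda>js. out (j # js)) K"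
    by (auto simp: records_Suc)
  show ?case
    unfolding js(1) locc_op_Suc sys_dim_Suc
    using Suc.prems(1) js adaptive_psd[OF Suc.prems(1) js(2)]
    by (intro kron_carrier Suc.IH) (auto simp: psd_def adaptive_Suc)
qed simp

lemma sum_records_Suc:
  fixes f :: "nat list \<Rightarrow> 'a::comm_monoid_add"
  assumes "finite (out [])" "\<And>j. j \<in> out [] \<Longrightarrow> finite (records (\<lambda>js. out (j # js)) s)"
  shows "(\<Sum>js\<in>records out (Suc s). f js) = (\<Sum>j\<in>out []. \<Sum>js\<in>records (\<lambda>js. out (j # js)) s. f (j # js))"
proof -
  have "(\<Sum>js\<in>records out (Suc s). f js) = (\<Sum>j\<in>out []. \<Sum>js\<in>(#) j ` records (\<lambda>js. out (j # js)) s. f js)"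
    unfolding records_Suc using assms by (intro sum.UNION_disjoint) auto
  also have "\<dots> = (\<Sum>j\<in>out []. \<Sum>js\<in>records (\<lambda>js. out (j # js)) s. f (j # js))"
  proof (rule sum.cong[OF refl])
    show "(\<Sum>js\<in>(#) j ` records (\<lambda>js. out (j # js)) s. f js)
        = (\<Sum>js\<in>records (\<lambda>js. out (j # js)) s. f (j # js))" for j
      by (simp add: sum.reindex)
  qed
  finally show ?thesis .
qed

lemma finite_records: "adaptive K d out A \<Longrightarrow> finite (records out K)"
proof (induction K arbitrary: d out A)
  case (Suc K)
  then show ?case unfolding adaptive_Suc records_Suc povm_def by blast
qed simp

section \<open>Completeness of adaptive measurements\<close>

lemma povm_sum:
  assumes "povm n I E" "k < n" "l < n"
  shows "(\<Sum>i\<in>I. E i $$ (k, l)) = (if k = l then 1 else 0)"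
proof -
  have "mat n n (\<lambda>p. \<Sum>i\<in>I. E i $$ p) $$ (k, l) = 1\<^sub>m n $$ (k, l)"
    using assms(1) by (simp add: povm_def)
  then show ?thesis using assms(2,3) by simp
qed

text \<open>Summing over the later outcomes first gives, by induction, the identity on the remaining
  factors for every \<open>j\<close>. This does not depend on \<open>j\<close>, so the POVM
  condition of the first party finishes the sum.\<close>

lemma locc_op_sum:
  "adaptive K d out A \<Longrightarrow> x < sys_dim K d \<Longrightarrow> y < sys_dim K d \<Longrightarrow>
     (\<Sum>js\<in>records out K. locc_op K A js $$ (x, y)) = (if x = y then 1 else 0)"
proof (induction K arbitrary: d out A x y)
  case (Suc K)
  define n where "n = sys_dim K (\<lambda>k. d (Suc k))"
  have xy: "x < d 0 * n" "y < d 0 * n" using Suc.prems by (auto simp: n_def sys_dim_Suc)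
  then have "n > 0" by (cases n) auto
  then have mods: "x mod n < n" "y mod n < n" by auto
  have divs: "x div n < d 0" "y div n < d 0" using xy by (auto simp: less_mult_imp_div_less)
  have rest: "adaptive K (\<lambda>k. d (Suc k)) (\<lambda>js. out (j # js)) (\<lambda>js. A (j # js))" if "j \<in> out []" for j
    using Suc.prems(1) that by (simp add: adaptive_Suc)
  have pov: "povm (d 0) (out []) (A [])" using Suc.prems(1) by (simp add: adaptive_Suc)
  have entry: "kron (A [] j) (locc_op K (\<lambda>js. A (j # js)) js) $$ (x, y)
      = A [] j $$ (x div n, y div n) * locc_op K (\<lambda>js. A (j # js)) js $$ (x mod n, y mod n)"
    if "j \<in> out []" "js \<in> records (\<lambda>js. out (j # js)) K" for j js
    using kron_index[OF _ locc_op_carrier[OF rest[OF that(1)] that(2), folded n_def] divs mods]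
      adaptive_psd[OF Suc.prems(1) that(1)] by (simp add: psd_def)
  have "(\<Sum>js\<in>records out (Suc K). locc_op (Suc K) A js $$ (x, y))
     = (\<Sum>j\<in>out []. \<Sum>js\<in>records (\<lambda>js. out (j # js)) K. kron (A [] j) (locc_op K (\<lambda>js. A (j # js)) js) $$ (x, y))"
    using pov finite_records[OF rest] by (subst sum_records_Suc) (auto simp: povm_def)
  also have "\<dots> = (\<Sum>j\<in>out []. A [] j $$ (x div n, y div n) *
      (\<Sum>js\<in>records (\<lambda>js. out (j # js)) K. locc_op K (\<lambda>js. A (j # js)) js $$ (x mod n, y mod n)))"
    by (intro sum.cong refl) (simp add: entry sum_distrib_left)
  also have "\<dots> = (\<Sum>j\<in>out []. A [] j $$ (x div n, y div n)) * (if x mod n = y mod n then 1 else 0)"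
    using Suc.IH[OF rest] mods unfolding n_def sum_distrib_right by (intro sum.cong refl) simp
  also have "\<dots> = (if x div n = y div n \<and> x mod n = y mod n then 1 else 0)"
    using povm_sum[OF pov divs] by simp
  also have "\<dots> = (if x = y then 1 else 0)" by (metis div_mod_decomp)
  finally show ?case .
qed simp

lemma locc_op_sum_quad:
  assumes "adaptive K d out A"
  shows "(\<Sum>js\<in>records out K. quad (locc_op K A js) f) = (\<Sum>x<sys_dim K d. cnj (f x) * f x)"
proof -
  let ?N = "sys_dim K d"
  have "(\<Sum>js\<in>records out K. quad (locc_op K A js) f)
     = (\<Sum>js\<in>records out K. \<Sum>x<?N. \<Sum>y<?N. cnj (f x) * locc_op K A js $$ (x, y) * f y)"
    by (intro sum.cong refl) (simp add: quad_def sform_def carrier_matD(1)[OF locc_op_carrier[OF assms]])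
  also have "\<dots> = (\<Sum>x<?N. \<Sum>js\<in>records out K. \<Sum>y<?N. cnj (f x) * locc_op K A js $$ (x, y) * f y)"
    by (rule sum.swap)
  also have "\<dots> = (\<Sum>x<?N. \<Sum>y<?N. \<Sum>js\<in>records out K. cnj (f x) * locc_op K A js $$ (x, y) * f y)"
    by (intro sum.cong refl sum.swap)
  also have "\<dots> = (\<Sum>x<?N. \<Sum>y<?N. if y = x then cnj (f x) * f x else 0)"
    using locc_op_sum[OF assms]
    by (intro sum.cong refl) (simp flip: sum_distrib_left sum_distrib_right)
  finally show ?thesis by simp
qed

text \<open>Parties beyond the first two enter the Bell estimate only through this entry, the one at
  |0...0>, which is a product of diagonal entries of positive matrices.\<close>

lemma locc_op_00_nonneg:
  "adaptive K d out A \<Longrightarrow> js \<in> records out K \<Longrightarrow> (\<And>k. k < K \<Longrightarrow> d k > 0) \<Longrightarrow> 0 \<le> locc_op K A js $$ (0, 0)"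
proof (induction K arbitrary: d out A js)
  case (Suc K)
  from Suc.prems(2) obtain j js' where js: "js = j # js'" "j \<in> out []" "js' \<in> records (\<lambda>js. out (j # js)) K"
    by (auto simp: records_Suc)
  let ?B = "locc_op K (\<lambda>js. A (j # js)) js'"
  have ad: "adaptive K (\<lambda>k. d (Suc k)) (\<lambda>js. out (j # js)) (\<lambda>js. A (j # js))"
    using Suc.prems(1) js(2) by (simp add: adaptive_Suc)
  have psd: "psd (d 0) (A [] j)" by (rule adaptive_psd[OF Suc.prems(1) js(2)])
  have B: "?B \<in> carrier_mat (sys_dim K (\<lambda>k. d (Suc k))) (sys_dim K (\<lambda>k. d (Suc k)))"
    by (rule locc_op_carrier[OF ad js(3)])
  have dim: "d 0 > 0" "sys_dim K (\<lambda>k. d (Suc k)) > 0"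
    using Suc.prems(3) by (auto simp: sys_dim_def)
  have "kron (A [] j) ?B $$ (0, 0) = A [] j $$ (0, 0) * ?B $$ (0, 0)"
    using kron_index[OF _ B dim(1) dim(1) dim(2) dim(2)] psd by (simp add: psd_def)
  moreover have "0 \<le> ?B $$ (0, 0)" using Suc.prems(3) by (intro Suc.IH[OF ad js(3)]) auto
  moreover have "0 \<le> A [] j $$ (0, 0)"
    using psd_diag[OF psd dim(1)] by (simp add: less_eq_complex_def)
  ultimately show ?case
    unfolding js(1) locc_op_Suc by (simp add: less_eq_complex_def)
qed (simp add: less_eq_complex_def)

lemma locc1_distinguishable_iff:
  "locc1_distinguishable K d S \<longleftrightarrow> (\<exists>out A. adaptive K d out A \<and>
     (\<forall>js\<in>records out K. \<forall>\<rho>\<in>S. \<forall>\<sigma>\<in>S.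
        mat_trace (locc_op K A js * \<rho>) \<noteq> 0 \<longrightarrow> mat_trace (locc_op K A js * \<sigma>) \<noteq> 0 \<longrightarrow> \<rho> = \<sigma>))"
    (is "?L \<longleftrightarrow> ?R")
proof
  assume ?L
  then show ?R
    unfolding locc1_distinguishable_def locc1_povm_def
    by (elim exE conjE, intro exI conjI) (simp_all add: adaptive_def locc_op_def)
next
  assume ?R
  then obtain out A where "adaptive K d out A"
    "\<forall>js\<in>records out K. \<forall>\<rho>\<in>S. \<forall>\<sigma>\<in>S.
        mat_trace (locc_op K A js * \<rho>) \<noteq> 0 \<longrightarrow> mat_trace (locc_op K A js * \<sigma>) \<noteq> 0 \<longrightarrow> \<rho> = \<sigma>"
    by blast
  then show ?L
    unfolding locc1_distinguishable_def locc1_povm_def adaptive_def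
    by (intro exI[of _ "records out K"] exI[of _ "locc_op K A"]) (auto simp: locc_op_def)
qed

(* The first party measures in an isotropic frame of the cross Gram matrix of the two vectors, so
   that the conditional vectors of the remaining parties stay orthogonal. *)
lemma orthogonal_pair_adaptive:
  assumes "(\<Sum>x<sys_dim K d. \<psi> x * cnj (\<phi> x)) = 0"
  shows "\<exists>out A. adaptive K d out A \<and>
    (\<forall>js\<in>records out K. quad (locc_op K A js) \<psi> = 0 \<or> quad (locc_op K A js) \<phi> = 0)"
  using assms
proof (induction K arbitrary: d \<psi> \<phi>)
  case 0
  then show ?case by (auto simp: quad_def sform_def)
next
  case (Suc K)
  define d' where "d' = (\<lambda>k. d (Suc k))"
  define n where "n = sys_dim K d'"
  define m where "m = d 0"
  \<comment> \<open>Block k of \<open>\<psi>\<close> against block l of \<open>\<phi>\<close>; the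
    diagonal blocks add up to the full inner product, so the trace is 0.\<close>
  define Z where "Z = (\<lambda>k l. \<Sum>x<n. \<psi> (k * n + x) * cnj (\<phi> (l * n + x)))"
  define cond where "cond = (\<lambda>v f x. \<Sum>i<m. cnj (v i) * f (i * n + x) :: complex)"
  have "(\<Sum>k<m. Z k k) = 0"
    using Suc.prems by (simp add: Z_def sys_dim_Suc sum_lessThan_mult m_def n_def d'_def)
  then obtain v where v: "frame m v" "\<forall>j<m. sform m Z (v j) (v j) = 0"
    using traceless_isotropic_frame by blast
  have orth: "(\<Sum>x<n. cond (v j) \<psi> x * cnj (cond (v j) \<phi> x)) = sform m Z (v j) (v j)" for j
  proof -
    have "(\<Sum>x<n. cond (v j) \<psi> x * cnj (cond (v j) \<phi> x))
       = (\<Sum>x<n. \<Sum>k<m. \<Sum>l<m. cnj (v j k) * \<psi> (k * n + x) * (v j l * cnj (\<phi> (l * n + x))))"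
      by (simp add: cond_def sum_product)
    also have "\<dots> = (\<Sum>k<m. \<Sum>x<n. \<Sum>l<m. cnj (v j k) * \<psi> (k * n + x) * (v j l * cnj (\<phi> (l * n + x))))"
      by (rule sum.swap)
    also have "\<dots> = (\<Sum>k<m. \<Sum>l<m. \<Sum>x<n. cnj (v j k) * \<psi> (k * n + x) * (v j l * cnj (\<phi> (l * n + x))))"
      by (intro sum.cong refl sum.swap)
    also have "\<dots> = sform m Z (v j) (v j)"
      unfolding sform_def Z_def sum_distrib_left sum_distrib_right
      by (intro sum.cong refl) (simp add: mult_ac)
    finally show ?thesis .
  qed
  have "\<forall>j\<in>{..<m}. \<exists>out A. adaptive K d' out A \<and> (\<forall>js\<in>records out K.
      quad (locc_op K A js) (cond (v j) \<psi>) = 0 \<or> quad (locc_op K A js) (cond (v j) \<phi>) = 0)"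
    using Suc.IH[where d = d'] orth v(2) unfolding n_def by simp
  then obtain out A where oA: "\<And>j. j < m \<Longrightarrow> adaptive K d' (out j) (A j) \<and> (\<forall>js\<in>records (out j) K.
      quad (locc_op K (A j) js) (cond (v j) \<psi>) = 0 \<or> quad (locc_op K (A j) js) (cond (v j) \<phi>) = 0)"
    unfolding bchoice_iff by auto
  \<comment> \<open>Gluing: the first outcome selects which of the protocols supplied by induction
    the remaining parties follow.\<close>
  define out' where "out' = (\<lambda>js. case js of [] \<Rightarrow> {..<m} | j # js \<Rightarrow> out j js)"
  define A' where "A' = (\<lambda>js. case js of [] \<Rightarrow> (\<lambda>j. rank_one m (v j)) | j # js \<Rightarrow> A j js)"
  have "adaptive (Suc K) d out' A'"
    using povm_frame[OF v(1)] oA unfolding adaptive_Suc by (simp add: out'_def A'_def m_def d'_def)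
  moreover have "quad (locc_op (Suc K) A' js) \<psi> = 0 \<or> quad (locc_op (Suc K) A' js) \<phi> = 0"
    if js: "js \<in> records out' (Suc K)" for js
  proof -
    from js obtain j js' where js': "js = j # js'" "j < m" "js' \<in> records (out j) K"
      by (auto simp: records_Suc out'_def)
    have "quad (locc_op (Suc K) A' js) f = quad (locc_op K (A j) js') (cond (v j) f)" for f
      using quad_kron_rank_one[of "locc_op K (A j) js'" n m "v j" f]
        locc_op_carrier[of K d' "out j" "A j" js'] oA[OF js'(2)] js'
      by (simp add: A'_def n_def cond_def)
    then show ?thesis using oA[OF js'(2)] js'(3) by simp
  qed
  ultimately show ?case by blast
qed

section \<open>Bell states\<close>

text \<open>Regrouping gives (x y)^2 at most (a c) (b e); then the inequality of arithmetic and
  geometric means applies to a c and b e.\<close>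

lemma two_mult_le_of_squares_le:
  fixes x y a b c e :: real
  assumes "x^2 \<le> a * b" "y^2 \<le> c * e" "a \<ge> 0" "b \<ge> 0" "c \<ge> 0" "e \<ge> 0"
  shows "2 * (x * y) \<le> a * c + b * e"
proof -
  have "(x * y)^2 \<le> (a * b) * (c * e)"
    unfolding power_mult_distrib using assms by (intro mult_mono) auto
  also have "4 * \<dots> \<le> (a * c + b * e)^2"
    using zero_le_power2[of "a * c - b * e"] by (simp add: power2_eq_square algebra_simps)
  finally have "(2 * (x * y))^2 \<le> (a * c + b * e)^2" by (simp add: power_mult_distrib)
  moreover have "0 \<le> a * c + b * e" using assms by simp
  ultimately show ?thesis by (rule power2_le_imp_le)
qed

lemma psd_product_cross_term:
  assumes E: "psd m E" "i < m" "j < m" and F: "psd n F" "k < n" "l < n"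
  shows "\<bar>Re (E $$ (i, j) * F $$ (k, l))\<bar> * 2 \<le>
    Re (E $$ (i, i)) * Re (F $$ (k, k)) + Re (E $$ (j, j)) * Re (F $$ (l, l))"
proof -
  have "\<bar>Re (E $$ (i, j) * F $$ (k, l))\<bar> \<le> cmod (E $$ (i, j)) * cmod (F $$ (k, l))"
    using abs_Re_le_cmod by (metis norm_mult)
  moreover have "2 * (cmod (E $$ (i, j)) * cmod (F $$ (k, l))) \<le>
    Re (E $$ (i, i)) * Re (F $$ (k, k)) + Re (E $$ (j, j)) * Re (F $$ (l, l))"
    using psd_minor[OF E] psd_minor[OF F] psd_diag(2)[OF E(1)] psd_diag(2)[OF F(1)] E F
    by (intro two_mult_le_of_squares_le) auto
  ultimately show ?thesis by simp
qed

text \<open>If \<open>r\<close> is the joint dimension of the later parties and \<open>n\<close>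
  that of the second, |i k 0...0> has index i * (n * r) + k * r. So |00>, |01>, |10>, |11> sit at 0,
  r, n * r, n * r + r, and \<open>s\<close> is the relative sign 1 or -1.\<close>

definition bell :: "nat \<Rightarrow> nat \<Rightarrow> real \<Rightarrow> nat \<Rightarrow> complex" where
  "bell p q s = (\<lambda>k. of_real (1 / sqrt 2) * of_bool (k = p) + of_real (s / sqrt 2) * of_bool (k = q))"

lemma quad_bell:
  assumes "M \<in> carrier_mat N N" "p < N" "q < N" "s^2 = 1"
  shows "Re (quad M (bell p q s)) = (Re (M $$ (p, p)) + Re (M $$ (q, q)) + s * (Re (M $$ (p, q)) + Re (M $$ (q, p)))) / 2"
proof -
  have s2: "sqrt 2 * sqrt 2 = (2::real)" by simp
  have ss: "s * s = 1" using assms(4) by (simp add: power2_eq_square)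
  have c: "cnj (of_real a) * of_real b = (of_real (a * b) :: complex)" for a b by simp
  show ?thesis
    unfolding bell_def quad_two_point[OF assms(1-3)] c
    by (simp add: s2 ss field_simps)
qed

text \<open>Twice a Bell overlap is the two diagonal entries on its support plus signed cross terms.
  Product form bounds the cross terms by the two diagonal entries off the support, and all four
  together are \<open>T\<close>.\<close>

lemma quad_bell_kron_le:
  assumes E: "psd m E" "m \<ge> 2" and F: "psd n F" "n \<ge> 2"
    and R: "R \<in> carrier_mat r r" "r > 0" "0 \<le> R $$ (0, 0)"
    and s: "s^2 = 1"
  defines "M \<equiv> kron E (kron F R)"
  defines "T \<equiv> Re (M $$ (0, 0)) + Re (M $$ (r, r)) + Re (M $$ (n * r, n * r)) + Re (M $$ (n * r + r, n * r + r))"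
  shows "2 * Re (quad M (bell 0 (n * r + r) s)) \<le> T" "2 * Re (quad M (bell r (n * r) s)) \<le> T" "0 \<le> T"
proof -
  have carE: "E \<in> carrier_mat m m" and carF: "F \<in> carrier_mat n n" using E F by (auto simp: psd_def)
  note carFR = kron_carrier[OF carF R(1)]
  have carM: "M \<in> carrier_mat (m * (n * r)) (m * (n * r))"
    unfolding M_def by (rule kron_carrier[OF carE carFR])
  define \<rho> where "\<rho> = Re (R $$ (0, 0))"
  have \<rho>: "R $$ (0, 0) = of_real \<rho>" "\<rho> \<ge> 0" using R(3) by (auto simp: \<rho>_def less_eq_complex_def complex_eq_iff)
  have M: "M $$ (i * (n * r) + k * r, j * (n * r) + l * r) = E $$ (i, j) * F $$ (k, l) * of_real \<rho>"
    if "i < m" "j < m" "k < n" "l < n" for i j k l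
  proof -
    \<comment> \<open>The \<open>+ 0\<close> displays the index of the last factor, so that
      \<open>kron_index\<close> applies a second time.\<close>
    have "M $$ (i * (n * r) + k * r, j * (n * r) + l * r) = E $$ (i, j) * kron F R $$ (k * r + 0, l * r + 0)"
      unfolding M_def using kron_index[OF carE carFR that(1,2), of "k * r" "l * r"]
        mult_add_less[OF that(3) R(2)] mult_add_less[OF that(4) R(2)] by simp
    also have "kron F R $$ (k * r + 0, l * r + 0) = F $$ (k, l) * of_real \<rho>"
      unfolding \<rho>(1)[symmetric] by (rule kron_index[OF carF R(1) that(3,4) R(2) R(2)])
    finally show ?thesis by simp
  qed
  define e f where "e = (\<lambda>i. Re (E $$ (i, i)))" and "f = (\<lambda>k. Re (F $$ (k, k)))"
  define x where "x = (\<lambda>i j k l. Re (E $$ (i, j) * F $$ (k, l)))"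
  have ReM: "Re (M $$ (i * (n * r) + k * r, j * (n * r) + l * r)) = x i j k l * \<rho>"
    if "i < m" "j < m" "k < n" "l < n" for i j k l
    unfolding M[OF that] x_def by simp
  have diag: "Re (M $$ (i * (n * r) + k * r, i * (n * r) + k * r)) = e i * f k * \<rho>"
    if "i < m" "k < n" for i k
    using ReM[OF that(1) that(1) that(2) that(2)] psd_diag(1)[OF E(1) that(1)] by (simp add: e_def f_def x_def)
  have small: "0 < m" "1 < m" "0 < n" "1 < n" using E F by auto
  have T: "T = (e 0 * f 0 + e 0 * f 1 + e 1 * f 0 + e 1 * f 1) * \<rho>"
    using diag[of 0 0] diag[of 0 1] diag[of 1 0] diag[of 1 1] small by (simp add: T_def algebra_simps)
  have nonneg: "e 0 \<ge> 0" "e 1 \<ge> 0" "f 0 \<ge> 0" "f 1 \<ge> 0"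
    using psd_diag(2)[OF E(1)] psd_diag(2)[OF F(1)] small by (auto simp: e_def f_def)
  show "0 \<le> T" unfolding T using nonneg \<rho>(2) by simp
  have s1: "s = 1 \<or> s = -1" using s by (simp add: power2_eq_1_iff)
  have x: "\<bar>x i j k l\<bar> * 2 \<le> e i * f k + e j * f l" "\<bar>x i j k l\<bar> * 2 \<le> e i * f l + e j * f k"
    if "i < m" "j < m" "k < n" "l < n" for i j k l
  proof -
    show "\<bar>x i j k l\<bar> * 2 \<le> e i * f k + e j * f l"
      using psd_product_cross_term[OF E(1) that(1,2) F(1) that(3,4)] by (simp add: x_def e_def f_def)
    \<comment> \<open>Swapping the indices of \<open>F\<close> keeps the modulus, so the diagonal
      entries can also be paired crosswise. This is positivity under partial transposition.\<close>
    have "F $$ (k, l) = cnj (F $$ (l, k))" using F(1) that unfolding psd_iff_quad by blast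
    moreover have "cmod (E $$ (i, j)) * cmod (F $$ (l, k)) * 2 \<le> e i * f l + e j * f k"
      using two_mult_le_of_squares_le[OF psd_minor[OF E(1) that(1,2)] psd_minor[OF F(1) that(4,3)]]
        psd_diag(2)[OF E(1)] psd_diag(2)[OF F(1)] that by (simp add: e_def f_def)
    moreover have "\<bar>x i j k l\<bar> \<le> cmod (E $$ (i, j)) * cmod (F $$ (k, l))"
      unfolding x_def using abs_Re_le_cmod by (metis norm_mult)
    ultimately show "\<bar>x i j k l\<bar> * 2 \<le> e i * f l + e j * f k" by simp
  qed
  have idx: "0 < m * (n * r)" "r < m * (n * r)" "n * r < m * (n * r)" "n * r + r < m * (n * r)"
    using mult_add_less[OF small(1) mult_add_less[OF small(3) R(2)]] mult_add_less[OF small(1) mult_add_less[OF small(4) R(2)]]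
      mult_add_less[OF small(2) mult_add_less[OF small(3) R(2)]] mult_add_less[OF small(2) mult_add_less[OF small(4) R(2)]]
    by simp_all
  have "2 * Re (quad M (bell 0 (n * r + r) s)) = (e 0 * f 0 + e 1 * f 1 + s * (x 0 1 0 1 + x 1 0 1 0)) * \<rho>"
    unfolding quad_bell[OF carM idx(1) idx(4) s]
    using diag[of 0 0] diag[of 1 1] ReM[of 0 1 0 1] ReM[of 1 0 1 0] small
    by (simp add: algebra_simps)
  also have "\<dots> \<le> T"
    unfolding T using x(2)[of 0 1 0 1] x(2)[of 1 0 1 0] small s1 \<rho>(2) by (intro mult_right_mono) auto
  finally show "2 * Re (quad M (bell 0 (n * r + r) s)) \<le> T" .
  have "2 * Re (quad M (bell r (n * r) s)) = (e 0 * f 1 + e 1 * f 0 + s * (x 0 1 1 0 + x 1 0 0 1)) * \<rho>"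
    unfolding quad_bell[OF carM idx(2) idx(3) s]
    using diag[of 0 1] diag[of 1 0] ReM[of 0 1 1 0] ReM[of 1 0 0 1] small
    by (simp add: algebra_simps)
  also have "\<dots> \<le> T"
    unfolding T using x(2)[of 0 1 1 0] x(2)[of 1 0 0 1] small s1 \<rho>(2) by (intro mult_right_mono) auto
  finally show "2 * Re (quad M (bell r (n * r) s)) \<le> T" .
qed

lemma bell_cscalar:
  assumes "p < N" "q < N" "p \<noteq> q"
  shows "vec N (bell p q s) \<bullet>c vec N (bell p' q' t) =
    (cnj (bell p' q' t p) + s * cnj (bell p' q' t q)) / sqrt 2"
proof -
  have "vec N (bell p q s) \<bullet>c vec N (bell p' q' t)
     = (\<Sum>k<N. (if k = p then cnj (bell p' q' t p) / sqrt 2 else 0) + (if k = q then s * cnj (bell p' q' t q) / sqrt 2 else 0))"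
  proof -
    have "bell p q s k * cnj (bell p' q' t k)
        = (if k = p then cnj (bell p' q' t p) / sqrt 2 else 0) + (if k = q then s * cnj (bell p' q' t q) / sqrt 2 else 0)" for k
      using assms(3) by (cases "k = p"; cases "k = q") (simp_all add: bell_def[of p q])
    then show ?thesis
      by (simp add: scalar_prod_def atLeast0LessThan)
  qed
  also have "\<dots> = (cnj (bell p' q' t p) + s * cnj (bell p' q' t q)) / sqrt 2"
    using assms by (simp add: sum.distrib add_divide_distrib)
  finally show ?thesis .
qed

lemma bell_neq:
  assumes "p \<noteq> q"
  shows "bell p q 1 \<noteq> bell p q (-1)" "p \<noteq> u \<Longrightarrow> p \<noteq> v \<Longrightarrow> bell p q s \<noteq> bell u v t"
proof -
  have "bell p q 1 q \<noteq> bell p q (-1) q" using assms by (simp add: bell_def complex_eq_iff)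
  then show "bell p q 1 \<noteq> bell p q (-1)" by metis
  assume "p \<noteq> u" "p \<noteq> v"
  then have "bell p q s p \<noteq> bell u v t p" using assms by (simp add: bell_def)
  then show "bell p q s \<noteq> bell u v t" by metis
qed

lemma bell_orthonormal:
  assumes "p < N" "q < N" "u < N" "v < N" "distinct [p, q, u, v]"
    and "f \<in> {bell p q 1, bell p q (-1), bell u v 1}" "g \<in> {bell p q 1, bell p q (-1), bell u v 1}"
  shows "vec N f \<bullet>c vec N g = of_bool (f = g)"
proof -
  have ne: "bell p q 1 \<noteq> bell p q (-1)" "bell p q s \<noteq> bell u v t" for s t
    using bell_neq(1)[of p q] bell_neq(2)[of p q u v] assms(5) by auto
  have sq: "complex_of_real (sqrt 2) * complex_of_real (sqrt 2) = 2"
    by (simp flip: of_real_mult)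
  have ip: "vec N (bell p q s) \<bullet>c vec N (bell p q t) = (1 + s * t) / 2"
    "vec N (bell u v s) \<bullet>c vec N (bell u v t) = (1 + s * t) / 2"
    "vec N (bell p q s) \<bullet>c vec N (bell u v t) = 0" "vec N (bell u v s) \<bullet>c vec N (bell p q t) = 0" for s t
    using assms(1-5) by (simp_all add: bell_cscalar) (auto simp: bell_def field_simps sq)
  show ?thesis
    using assms(6,7) ne ne(2)[symmetric] by (auto simp: ip)
qed

(* A product effect overlaps any Bell state in at most half of its trace on the two-qubit subspace.
   If each effect detects at most one of three Bell states, summing over the effects
   gives 3 \<le> 4 / 2. *)
lemma three_bell_states_indistinguishable:
  assumes "d 0 \<ge> 2" "d (Suc 0) \<ge> 2" "\<And>k. k < Suc (Suc K) \<Longrightarrow> d k > 0"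
  defines "n \<equiv> d (Suc 0)" and "r \<equiv> sys_dim K (\<lambda>k. d (Suc (Suc k)))"
  assumes ad: "adaptive (Suc (Suc K)) d out A"
    and B: "B = {bell 0 (n * r + r) 1, bell 0 (n * r + r) (-1), bell r (n * r) 1}"
  shows "\<exists>js\<in>records out (Suc (Suc K)). \<exists>f\<in>B. \<exists>g\<in>B. f \<noteq> g \<and>
    quad (locc_op (Suc (Suc K)) A js) f \<noteq> 0 \<and> quad (locc_op (Suc (Suc K)) A js) g \<noteq> 0"
proof (rule ccontr)
  let ?K = "Suc (Suc K)"
  let ?N = "sys_dim ?K d"
  let ?M = "locc_op ?K A"
  define b1 b2 b3 where b: "b1 = bell 0 (n * r + r) 1" "b2 = bell 0 (n * r + r) (-1)" "b3 = bell r (n * r) 1"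
  define T where "T = (\<lambda>js. Re (?M js $$ (0, 0)) + Re (?M js $$ (r, r)) +
    Re (?M js $$ (n * r, n * r)) + Re (?M js $$ (n * r + r, n * r + r)))"
  assume "\<not> ?thesis"
  then have excl: "quad (?M js) f = 0 \<or> quad (?M js) g = 0"
    if "js \<in> records out ?K" "f \<in> {b1, b2, b3}" "g \<in> {b1, b2, b3}" "f \<noteq> g" for js f g
    using that unfolding B b by blast
  have r: "r > 0" using assms(3) unfolding r_def sys_dim_def by (auto simp: prod_pos)
  have n: "n \<ge> 2" using assms(2) by (simp add: n_def)
  have N: "?N = d 0 * (n * r)" by (simp add: sys_dim_Suc n_def r_def)
  have "2 * (n * r) \<le> ?N" unfolding N using assms(1) by (intro mult_le_mono1)
  moreover have "2 * r \<le> n * r" using n by (intro mult_le_mono1)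
  ultimately have idx: "0 < ?N" "r < ?N" "n * r < ?N" "n * r + r < ?N" "r \<noteq> n * r" "r < n * r"
    using r by linarith+
  have distinct: "b1 \<noteq> b2" "b1 \<noteq> b3" "b2 \<noteq> b3"
    using bell_neq(1)[of 0 "n * r + r"] bell_neq(2)[of 0 "n * r + r" r "n * r"] r idx unfolding b by auto
  have bound: "Re (quad (?M js) b1) + Re (quad (?M js) b2) + Re (quad (?M js) b3) \<le> T js / 2"
    if js: "js \<in> records out ?K" for js
  proof -
    obtain i j js' where js': "js = i # j # js'" "i \<in> out []" "j \<in> out [i]"
      "js' \<in> records (\<lambda>js. out (i # j # js)) K"
      using js by (auto simp: records_Suc)
    have ad1: "adaptive (Suc K) (\<lambda>k. d (Suc k)) (\<lambda>js. out (i # js)) (\<lambda>js. A (i # js))"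
      using ad js'(2) unfolding adaptive_Suc[of "Suc K"] by blast
    then have ad2: "adaptive K (\<lambda>k. d (Suc (Suc k))) (\<lambda>js. out (i # j # js)) (\<lambda>js. A (i # j # js))"
      using js'(3) unfolding adaptive_Suc by blast
    have E: "psd (d 0) (A [] i)" by (rule adaptive_psd[OF ad js'(2)])
    have F: "psd n (A [i] j)" using adaptive_psd[OF ad1 js'(3)] by (simp add: n_def)
    define R where "R = locc_op K (\<lambda>js. A (i # j # js)) js'"
    have R: "R \<in> carrier_mat r r" "0 \<le> R $$ (0, 0)"
      using locc_op_carrier[OF ad2 js'(4)] locc_op_00_nonneg[OF ad2 js'(4)] assms(3)
      by (simp_all add: R_def r_def)
    have M: "?M js = kron (A [] i) (kron (A [i] j) R)" by (simp add: js'(1) R_def)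
    note le = quad_bell_kron_le[OF E assms(1) F n R(1) r R(2), folded M]
    have "2 * Re (quad (?M js) b1) \<le> T js" "2 * Re (quad (?M js) b2) \<le> T js"
      "2 * Re (quad (?M js) b3) \<le> T js" "0 \<le> T js"
      using le(1)[of 1] le(1)[of "-1"] le(2)[of 1] le(3)[of 1] by (simp_all add: b T_def)
    \<comment> \<open>At most one of the three overlaps is nonzero, so their sum obeys the bound for
      one; \<open>0 \<le> T js\<close> covers records that detect none.\<close>
    then show ?thesis
      using excl[OF js, of b1 b2] excl[OF js, of b1 b3] excl[OF js, of b2 b3] distinct by auto
  qed
  have norm: "(\<Sum>js\<in>records out ?K. Re (quad (?M js) f)) = 1" if "f \<in> {b1, b2, b3}" for f
  proof -
    have "(\<Sum>x<?N. cnj (f x) * f x) = vec ?N f \<bullet>c vec ?N f"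
      by (simp add: scalar_prod_def atLeast0LessThan mult.commute)
    also have "\<dots> = 1"
      using bell_orthonormal[of 0 ?N "n * r + r" r "n * r" f f] that idx r unfolding b by auto
    finally show ?thesis
      using locc_op_sum_quad[OF ad, of f] by (simp flip: Re_sum)
  qed
  have "(\<Sum>js\<in>records out ?K. Re (?M js $$ (x, x))) = 1" if "x < ?N" for x
    using locc_op_sum[OF ad that that] by (simp flip: Re_sum)
  then have "(\<Sum>js\<in>records out ?K. T js) = 4"
    unfolding T_def sum.distrib using idx by simp
  moreover have "(\<Sum>js\<in>records out ?K. Re (quad (?M js) b1) + Re (quad (?M js) b2) + Re (quad (?M js) b3)) = 3"
    unfolding sum.distrib using norm[of b1] norm[of b2] norm[of b3] by simp
  moreover have "(\<Sum>js\<in>records out ?K. Re (quad (?M js) b1) + Re (quad (?M js) b2) + Re (quad (?M js) b3))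
     \<le> (\<Sum>js\<in>records out ?K. T js / 2)"
    by (intro sum_mono bound)
  ultimately show False by (simp flip: sum_divide_distrib)
qed

section \<open>The threshold 2: pairs always succeed, three Bell states fail\<close>

theorem corollary1:
  fixes K :: nat and d :: "nat \<Rightarrow> nat"
  assumes "K \<ge> 2" and "\<And>k. k < K \<Longrightarrow> d k \<ge> 2"
  shows "all_orthogonal_sets_distinguishable K d 2 \<and>
    (\<forall>T. all_orthogonal_sets_distinguishable K d T \<longrightarrow> T \<le> 2)"
proof (intro conjI allI impI)
  let ?N = "sys_dim K d"
  show "all_orthogonal_sets_distinguishable K d 2"
    unfolding all_orthogonal_sets_distinguishable_def
  proof (intro allI impI)
    fix \<Psi> assume sub: "\<Psi> \<subseteq> pure_states ?N"
      and prems: "finite \<Psi> \<and> card \<Psi> \<le> 2 \<and> pairwise (\<lambda>\<psi> \<phi>. \<psi> \<bullet>c \<phi> = 0) \<Psi>"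
    have "\<exists>f g. (\<Sum>x<?N. f x * cnj (g x)) = 0 \<and>
        (\<forall>\<psi>\<in>\<Psi>. \<forall>\<phi>\<in>\<Psi>. \<psi> \<noteq> \<phi> \<longrightarrow> f = vec_index \<psi> \<and> g = vec_index \<phi> \<or> f = vec_index \<phi> \<and> g = vec_index \<psi>)"
    proof (cases "card \<Psi> = 2")
      case True
      then obtain \<psi> \<phi> where \<psi>: "\<Psi> = {\<psi>, \<phi>}" "\<psi> \<noteq> \<phi>" by (auto simp: card_2_iff)
      then have "\<psi> \<bullet>c \<phi> = 0" "dim_vec \<phi> = ?N"
        using prems sub by (auto simp: pairwise_insert pure_states_def)
      then have "(\<Sum>x<?N. \<psi> $ x * cnj (\<phi> $ x)) = 0"
        by (simp add: scalar_prod_def atLeast0LessThan)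
      then show ?thesis unfolding \<psi>(1)
        by (intro exI[of _ "vec_index \<psi>"] exI[of _ "vec_index \<phi>"]) blast
    next
      case False
      then have "card \<Psi> \<le> 1" using prems by linarith
      then have "\<forall>\<psi>\<in>\<Psi>. \<forall>\<phi>\<in>\<Psi>. \<psi> = \<phi>" using prems by (simp add: card_le_Suc0_iff_eq)
      \<comment> \<open>With at most one state the second condition is vacuous; zero functions
        merely serve to obtain some adaptive protocol.\<close>
      then show ?thesis by (intro exI[of _ "\<lambda>_. 0"]) auto
    qed
    then obtain f g where fg: "(\<Sum>x<?N. f x * cnj (g x)) = 0"
      "\<And>\<psi> \<phi>. \<psi> \<in> \<Psi> \<Longrightarrow> \<phi> \<in> \<Psi> \<Longrightarrow> \<psi> \<noteq> \<phi> \<Longrightarrow>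
         f = vec_index \<psi> \<and> g = vec_index \<phi> \<or> f = vec_index \<phi> \<and> g = vec_index \<psi>" by blast
    obtain out A where ad: "adaptive K d out A"
      "\<forall>js\<in>records out K. quad (locc_op K A js) f = 0 \<or> quad (locc_op K A js) g = 0"
      using orthogonal_pair_adaptive[OF fg(1)] by blast
    have tr: "mat_trace (locc_op K A js * ket_bra \<psi>) = quad (locc_op K A js) (vec_index \<psi>)"
      if "js \<in> records out K" "\<psi> \<in> \<Psi>" for js \<psi>
      using mat_trace_ket_bra[OF locc_op_carrier[OF ad(1) that(1)], of \<psi>] that(2) sub
      by (auto simp: pure_states_def)
    have "ket_bra \<psi> = ket_bra \<phi>"
      if "js \<in> records out K" "\<psi> \<in> \<Psi>" "\<phi> \<in> \<Psi>"
        "mat_trace (locc_op K A js * ket_bra \<psi>) \<noteq> 0" "mat_trace (locc_op K A js * ket_bra \<phi>) \<noteq> 0" for js \<psi> \<phi>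
      using fg(2)[OF that(2,3)] ad(2) that(1,4,5) unfolding tr[OF that(1,2)] tr[OF that(1,3)] by blast
    then show "locc1_distinguishable K d (ket_bra ` \<Psi>)"
      unfolding locc1_distinguishable_iff using ad(1) by blast
  qed
next
  fix T assume all: "all_orthogonal_sets_distinguishable K d T"
  show "T \<le> 2"
  proof (rule ccontr)
    assume "\<not> T \<le> 2"
    obtain K' where K: "K = Suc (Suc K')" using assms(1) by (metis add_2_eq_Suc le_Suc_ex)
    define N where "N = sys_dim K d"
    define n where "n = d (Suc 0)"
    define r where "r = sys_dim K' (\<lambda>k. d (Suc (Suc k)))"
    have dims: "d 0 \<ge> 2" "n \<ge> 2" and pos: "\<And>k. k < K \<Longrightarrow> d k > 0"
      using assms K by (force simp: n_def)+
    have r: "r > 0" using pos unfolding r_def sys_dim_def K by (auto simp: prod_pos)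
    have N: "N = d 0 * (n * r)" by (simp add: N_def K sys_dim_Suc n_def r_def)
    have "2 * (n * r) \<le> N" unfolding N using dims(1) by (intro mult_le_mono1)
    moreover have "2 * r \<le> n * r" using dims(2) by (intro mult_le_mono1)
    ultimately have idx: "0 < N" "r < N" "n * r < N" "n * r + r < N" "r < n * r"
      using r by linarith+
    define B where "B = {bell 0 (n * r + r) 1, bell 0 (n * r + r) (-1), bell r (n * r) 1}"
    define \<Psi> where "\<Psi> = vec N ` B"
    have ip: "vec N f \<bullet>c vec N g = of_bool (f = g)" if "f \<in> B" "g \<in> B" for f g
      using bell_orthonormal[of 0 N "n * r + r" r "n * r" f g] that idx r unfolding B_def by auto
    have "\<Psi> \<subseteq> pure_states N" by (auto simp: \<Psi>_def pure_states_def ip)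
    moreover have "finite \<Psi>" by (simp add: \<Psi>_def B_def)
    moreover have "card \<Psi> \<le> T"
    proof -
      have "card \<Psi> \<le> card B" unfolding \<Psi>_def by (rule card_image_le) (simp add: B_def)
      also have "card B \<le> 3" unfolding B_def by (rule card_insert_le_m1; simp add: card_insert_if)
      finally show ?thesis using \<open>\<not> T \<le> 2\<close> by linarith
    qed
    moreover have "pairwise (\<lambda>\<psi> \<phi>. \<psi> \<bullet>c \<phi> = 0) \<Psi>"
      unfolding pairwise_def \<Psi>_def using ip by auto
    ultimately have "locc1_distinguishable K d (ket_bra ` \<Psi>)"
      using all unfolding all_orthogonal_sets_distinguishable_def N_def by blast
    then obtain out A where ad: "adaptive K d out A"
      and dist: "\<forall>js\<in>records out K. \<forall>f\<in>B. \<forall>g\<in>B.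
        mat_trace (locc_op K A js * ket_bra (vec N f)) \<noteq> 0 \<longrightarrow>
        mat_trace (locc_op K A js * ket_bra (vec N g)) \<noteq> 0 \<longrightarrow> ket_bra (vec N f) = ket_bra (vec N g)"
      unfolding locc1_distinguishable_iff \<Psi>_def ball_simps by blast
    obtain js f g where js: "js \<in> records out K" "f \<in> B" "g \<in> B" "f \<noteq> g"
      "quad (locc_op K A js) f \<noteq> 0" "quad (locc_op K A js) g \<noteq> 0"
      using three_bell_states_indistinguishable[of d K' out A B] dims pos ad
      unfolding K n_def r_def B_def by blast
    have tr: "mat_trace (locc_op K A js * ket_bra (vec N h)) = quad (locc_op K A js) h" for h
    proof -
      have car: "locc_op K A js \<in> carrier_mat N N"
        unfolding N_def by (rule locc_op_carrier[OF ad js(1)])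
      show ?thesis
        unfolding mat_trace_ket_bra[OF car vec_carrier] using car by (simp add: quad_def sform_def)
    qed
    \<comment> \<open>Distinguishability only identifies density operators, so different Bell
      vectors must be seen to have different ones: applied to the second vector, one operator gives
      0 and the other that vector itself.\<close>
    have "ket_bra (vec N f) *\<^sub>v vec N g = ket_bra (vec N g) *\<^sub>v vec N g"
      using dist[rule_format, OF js(1-3)] js(5,6) unfolding tr by simp
    moreover have "ket_bra (vec N h) *\<^sub>v vec N g = (vec N g \<bullet>c vec N h) \<cdot>\<^sub>v vec N h" for h
    proof (rule eq_vecI)
      fix i assume "i < dim_vec ((vec N g \<bullet>c vec N h) \<cdot>\<^sub>v vec N h)"
      then have i: "i < N" by simp
      have "(ket_bra (vec N h) *\<^sub>v vec N g) $ i = (\<Sum>k<N. h i * cnj (h k) * g k)"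
        using i by (simp add: ket_bra_def scalar_prod_def atLeast0LessThan)
      also have "\<dots> = (\<Sum>k<N. g k * cnj (h k)) * h i"
        unfolding sum_distrib_right by (intro sum.cong refl) simp
      finally show "(ket_bra (vec N h) *\<^sub>v vec N g) $ i = ((vec N g \<bullet>c vec N h) \<cdot>\<^sub>v vec N h) $ i"
        using i by (simp add: scalar_prod_def atLeast0LessThan)
    qed (simp add: ket_bra_def)
    ultimately have "0 \<cdot>\<^sub>v vec N f = 1 \<cdot>\<^sub>v vec N g"
      using ip js(2-4) by simp
    then have "vec N g \<bullet>c vec N g = (0 \<cdot>\<^sub>v vec N f) \<bullet>c vec N g" by simp
    then show False using ip[OF js(3,3)] by (simp add: scalar_prod_def)
  qed
qed

end
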